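(* Suppose $L^1$ and $L^2$ each satisfy: (1) $\partial_x L,\partial_a L:\mathbb{R}^d\times\mathbb{R}^d\times\mathcal{P}_2(\mathbb{R}^{2d})\to\mathbb{R}^d$ exist and are uniformly Lipschitz continuous in $(x,a,\rho)$ with constant $C_{Lip}$, with respect to $\mathrm{W}_1$ in $\rho$. (2) (i) There is $c_0>0$ such that for all $x,a_1,a_2\in\mathbb{R}^d$, $\rho\in\mathcal{P}_2(\mathbb{R}^{2d})$, $L(x,a_2,\rho)-L(x,a_1,\rho)-\partial_aL(x,a_1,\rho)\cdot(a_2-a_1)\ge\frac{c_0}{2}|a_2-a_1|^2$. (ii) There are $c_1<c_0$ and $C>0$ such that for all $x,a\in\mathbb{R}^d$ and all square-integrable $\mathbb{R}^d$-valued random variables $X^1,X^2,\alpha^1,\alpha^2$, $|\partial_aL(x,a,\mathcal{L}(X^1,\alpha^1))-\partial_aL(x,a,\mathcal{L}(X^2,\alpha^2))|\le C\mathbb{E}[|X^1-X^2|]+c_1\mathbb{E}[|\alpha^1-\alpha^2|]$. (3) There is $C>0$ such that for all $(x,a,\rho)$, $\frac1C|a|^2-C(1+|x|^2+\mathrm{W}_2(\rho,\delta_{(0,0)}))\le L(x,a,\rho)\le C|a|^2+C(1+|x|^2+\mathrm{W}_2(\rho,\delta_{(0,0)}))$. Let $H^1,H^2$ be the corresponding Hamiltonians and $\Phi^1,\Phi^2$ the corresponding fixed-point maps. Then there is a constant $C$ such that for any $\nu=\mathcal{L}(X,Y)\in\mathcal{P}_2(\mathbb{R}^{2d})$, $$\mathrm{W}_1(\Phi^1(\nu),\Phi^2(\nu))\le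 C\,\mathbb{E}\big[|\partial_pH^1(X,Y,\Phi^2(\nu))-\partial_pH^2(X,Y,\Phi^2(\nu))|\big].$$
   Context: $L^i:\mathbb{R}^d\times\mathbb{R}^d\times\mathcal{P}_2(\mathbb{R}^{2d})\to\mathbb{R}$ ($i=1,2$) are Lagrangians, $H^i(x,p,\rho)=\inf_{a\in\mathbb{R}^d}\{p\cdot a+L^i(x,a,\rho)\}$. For $\nu=\mathcal{L}(X,Y)\in\mathcal{P}_2(\mathbb{R}^{2d})$ ($X,Y$ $\mathbb{R}^d$-valued square-integrable), $\Phi^i(\nu)\in\mathcal{P}_2(\mathbb{R}^{2d})$ is the unique fixed point of $\rho\mapsto\mathcal{L}(X,\partial_pH^i(X,Y,\rho))$; under the stated hypotheses it exists, is unique, and $\Phi^i$ is $\mathrm{W}_1$-Lipschitz. $\mathcal{P}_2$: probability measures with finite second moment; $\mathrm{W}_p$: $p$-Wasserstein distance; $\mathcal{L}(\cdot)$: law. *)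

theory Defs
  imports "HOL-Probability.Probability"
begin

definition P2 :: "'b::euclidean_space measure set" where
  "P2 = {\<mu>. prob_space \<mu> \<and> sets \<mu> = sets borel \<and> integrable \<mu> (\<lambda>z. (norm z)\<^sup>2)}"

definition couplings :: "'b::euclidean_space measure \<Rightarrow> 'b measure \<Rightarrow> ('b \<times> 'b) measure set" where
  "couplings \<mu> \<nu> = {\<pi>. prob_space \<pi> \<and> sets \<pi> = sets borel \<and>
     distr \<pi> borel fst = \<mu> \<and> distr \<pi> borel snd = \<nu>}"

(* The infimum is finite for p \<in> {1,2} and \<mu>, \<nu> \<in> P2, the only case used; there enn2real
   loses nothing. *)
definition wasserstein :: "real \<Rightarrow> 'b::euclidean_space measure \<Rightarrow> 'b measure \<Rightarrow> real" where
  "wasserstein p \<mu> \<nu> =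
     enn2real (INF \<pi>\<in>couplings \<mu> \<nu>. \<integral>\<^sup>+ z. ennreal (dist (fst z) (snd z) powr p) \<partial>\<pi>) powr (1 / p)"

definition square_integrable :: "'w measure \<Rightarrow> ('w \<Rightarrow> 'b::euclidean_space) \<Rightarrow> bool" where
  "square_integrable M X \<longleftrightarrow> X \<in> borel_measurable M \<and> integrable M (\<lambda>\<omega>. (norm (X \<omega>))\<^sup>2)"

definition law ::
  "'w measure \<Rightarrow> ('w \<Rightarrow> 'a::euclidean_space) \<Rightarrow> ('w \<Rightarrow> 'a) \<Rightarrow> ('a \<times> 'a) measure" where
  "law M X Y = distr M borel (\<lambda>\<omega>. (X \<omega>, Y \<omega>))"

(* Unspecified at points where f is not differentiable. *)
definition grad :: "('a::euclidean_space \<Rightarrow> real) \<Rightarrow> 'a \<Rightarrow> 'a" where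
  "grad f x = (THE D. GDERIV f x :> D)"

type_synonym 'a lagrangian = "'a \<Rightarrow> 'a \<Rightarrow> ('a \<times> 'a) measure \<Rightarrow> real"

definition dx :: "'a::euclidean_space lagrangian \<Rightarrow> 'a \<Rightarrow> 'a \<Rightarrow> ('a \<times> 'a) measure \<Rightarrow> 'a" where
  "dx L x a \<rho> = grad (\<lambda>x'. L x' a \<rho>) x"

definition da :: "'a::euclidean_space lagrangian \<Rightarrow> 'a \<Rightarrow> 'a \<Rightarrow> ('a \<times> 'a) measure \<Rightarrow> 'a" where
  "da L x a \<rho> = grad (\<lambda>a'. L x a' \<rho>) a"

definition lipschitz_derivatives :: "'a::euclidean_space lagrangian \<Rightarrow> bool" where
  "lipschitz_derivatives L \<longleftrightarrow>
     (\<forall>x a. \<forall>\<rho>\<in>P2. (\<exists>D. GDERIV (\<lambda>x'. L x' a \<rho>) x :> D) \<and> (\<exists>D. GDERIV (\<lambda>a'. L x a' \<rho>) a :> D)) \<and>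
     (\<exists>CLip. \<forall>x1 x2 a1 a2. \<forall>\<rho>1\<in>P2. \<forall>\<rho>2\<in>P2.
        norm (dx L x1 a1 \<rho>1 - dx L x2 a2 \<rho>2)
          \<le> CLip * (norm (x1 - x2) + norm (a1 - a2) + wasserstein 1 \<rho>1 \<rho>2) \<and>
        norm (da L x1 a1 \<rho>1 - da L x2 a2 \<rho>2)
          \<le> CLip * (norm (x1 - x2) + norm (a1 - a2) + wasserstein 1 \<rho>1 \<rho>2))"

(* The random variables range over all probability spaces M on the carrier of (R^d)^4. Every
   joint law of (X1, \<alpha>1, X2, \<alpha>2) is realised there by the coordinate maps, so this is the same
   as quantifying over all probability spaces whatsoever. *)
definition convex_displacement :: "'a::euclidean_space lagrangian \<Rightarrow> bool" where
  "convex_displacement L \<longleftrightarrow>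
     (\<exists>c0>0.
        (\<forall>x a1 a2. \<forall>\<rho>\<in>P2.
           L x a2 \<rho> - L x a1 \<rho> - da L x a1 \<rho> \<bullet> (a2 - a1) \<ge> c0 / 2 * (norm (a2 - a1))\<^sup>2) \<and>
        (\<exists>c1<c0. \<exists>C>0. \<forall>x a. \<forall>(M :: (('a \<times> 'a) \<times> ('a \<times> 'a)) measure) X1 X2 \<alpha>1 \<alpha>2.
           prob_space M \<longrightarrow>
           square_integrable M X1 \<longrightarrow> square_integrable M X2 \<longrightarrow>
           square_integrable M \<alpha>1 \<longrightarrow> square_integrable M \<alpha>2 \<longrightarrow>
           norm (da L x a (law M X1 \<alpha>1) - da L x a (law M X2 \<alpha>2))
             \<le> C * (\<integral>\<omega>. norm (X1 \<omega> - X2 \<omega>) \<partial>M) + c1 * (\<integral>\<omega>. norm (\<alpha>1 \<omega> - \<alpha>2 \<omega>) \<partial>M)))"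

definition quadratic_growth :: "'a::euclidean_space lagrangian \<Rightarrow> bool" where
  "quadratic_growth L \<longleftrightarrow>
     (\<exists>C>0. \<forall>x a. \<forall>\<rho>\<in>P2.
        1 / C * (norm a)\<^sup>2 - C * (1 + (norm x)\<^sup>2 + wasserstein 2 \<rho> (return borel (0, 0))) \<le> L x a \<rho> \<and>
        L x a \<rho> \<le> C * (norm a)\<^sup>2 + C * (1 + (norm x)\<^sup>2 + wasserstein 2 \<rho> (return borel (0, 0))))"

definition hamiltonian ::
  "'a::euclidean_space lagrangian \<Rightarrow> 'a \<Rightarrow> 'a \<Rightarrow> ('a \<times> 'a) measure \<Rightarrow> real" where
  "hamiltonian L x p \<rho> = (INF a. p \<bullet> a + L x a \<rho>)"

definition dpH :: "'a::euclidean_space lagrangian \<Rightarrow> 'a \<Rightarrow> 'a \<Rightarrow> ('a \<times> 'a) measure \<Rightarrow> 'a" where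
  "dpH L x p \<rho> = grad (\<lambda>p'. hamiltonian L x p' \<rho>) p"

(* The law of (X, dpH L X Y \<rho>) depends on (X, Y) only through \<nu>, so X and Y are taken to be the
   coordinate projections on the probability space \<nu>. *)
definition fixpoint_map ::
  "'a::euclidean_space lagrangian \<Rightarrow> ('a \<times> 'a) measure \<Rightarrow> ('a \<times> 'a) measure" where
  "fixpoint_map L \<nu> =
     (THE \<rho>. \<rho> \<in> P2 \<and> \<rho> = law \<nu> fst (\<lambda>z. dpH L (fst z) (snd z) \<rho>))"

end

theory Submission
  imports Defs
begin

text \<open>
  Everything rests on one contraction. The function \<open>a \<mapsto> p \<bullet> a + L x a \<rho>\<close> is strongly convex, so it has
  exactly one critical point, which is its minimiser, and by the envelope theorem this minimiser is
  \<open>dpH L x p \<rho>\<close> (\<open>strongly_convex.GDERIV_INF\<close>). Thus \<open>dpH\<close> is characterised by the first order condition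
  \<open>da L x (dpH L x p \<rho>) \<rho> = - p\<close>, and since \<open>da L x\<close> expands distances in \<open>a\<close> by at least \<open>c0\<close>, every
  Lipschitz estimate for \<open>da\<close> becomes one for \<open>dpH\<close>, divided by \<open>c0\<close>. For two laws with the same
  first component the displacement hypothesis gives the rate \<open>k = max 0 c1 / c0 < 1\<close>:
  \<open>|dpH L x p (law \<nu> fst \<alpha>) - dpH L x p (law \<nu> fst \<beta>)| \<le> k \<integral> |\<alpha> - \<beta>| d\<nu>\<close>
  (\<open>contractive_lagrangian.dpH_law\<close>). The left side depends on \<open>x\<close> and \<open>p\<close>, the right side does not.

  The contraction has two uses. First, Banach's theorem applied to feedback functions \<open>\<alpha>\<close> shows that
  the fixed point defining \<open>fixpoint_map L \<nu>\<close> exists and is unique, which makes the definite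
  description in \<open>fixpoint_map\<close> meaningful (\<open>contractive_lagrangian.fixpoint_map\<close>). Secondly, let
  \<open>\<alpha>\<close> and \<open>\<beta>\<close> be the feedbacks of the two fixed points \<open>\<sigma>\<close> (of \<open>L1\<close>) and \<open>\<rho>\<close> (of \<open>L2\<close>), and insert
  \<open>\<gamma> = dpH L1 _ _ \<rho>\<close> between them. The contraction for \<open>L1\<close> bounds \<open>|\<alpha> - \<gamma>|\<close> by \<open>k \<integral> |\<alpha> - \<beta>| d\<nu>\<close>, whence
  \<open>(1 - k) \<integral> |\<alpha> - \<beta>| d\<nu> \<le> \<integral> |\<gamma> - \<beta>| d\<nu>\<close>. The coupling of \<open>\<sigma>\<close> and \<open>\<rho>\<close> that shares the first component
  bounds their distance by \<open>\<integral> |\<alpha> - \<beta>| d\<nu>\<close> (\<open>wasserstein_1_distr_le\<close>), so the constant \<open>1 / (1 - k)\<close>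
  works.
\<close>

section \<open>Gradients and strongly convex functions\<close>

lemma GDERIV_unique:
  assumes "GDERIV f x :> D" "GDERIV f x :> E"
  shows "D = E"
proof -
  have "(\<lambda>h. h \<bullet> D) = (\<lambda>h. h \<bullet> E)"
    using assms unfolding gderiv_def by (rule has_derivative_unique)
  then have "(D - E) \<bullet> (D - E) = 0"
    by (metis inner_diff_right right_minus_eq)
  then show ?thesis by simp
qed

lemma grad_eqI: "GDERIV f x :> D \<Longrightarrow> grad f x = D"
  unfolding grad_def by (rule the_equality) (auto intro: GDERIV_unique)

lemma GDERIV_quadratic_bound:
  fixes f :: "'a::euclidean_space \<Rightarrow> real"
  assumes bound: "\<And>y. \<bar>f y - f x - (y - x) \<bullet> D\<bar> \<le> B * (norm (y - x))\<^sup>2"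
  shows "GDERIV f x :> D"
  unfolding gderiv_def has_derivative_at2
proof (intro conjI)
  show "bounded_linear (\<lambda>h. h \<bullet> D)" by (rule bounded_linear_inner_left)
  have "((\<lambda>y. B * norm (y - x)) \<longlongrightarrow> B * norm (x - x)) (at x)"
    by (intro tendsto_intros)
  then have lim: "((\<lambda>y. B * norm (y - x)) \<longlongrightarrow> 0) (at x)" by simp
  show "((\<lambda>y. (1 / norm (y - x)) *\<^sub>R (f y - (f x + (y - x) \<bullet> D))) \<longlongrightarrow> 0) (at x)"
  proof (rule Lim_null_comparison[OF _ lim])
    have "norm ((1 / norm (y - x)) *\<^sub>R (f y - (f x + (y - x) \<bullet> D))) \<le> B * norm (y - x)"
      if "y \<noteq> x" for y
    proof -
      have "\<bar>f y - (f x + (y - x) \<bullet> D)\<bar> \<le> B * norm (y - x) * norm (y - x)"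
        using bound[of y] by (simp add: power2_eq_square algebra_simps)
      then show ?thesis using that by (simp add: divide_simps)
    qed
    then show "\<forall>\<^sub>F y in at x. norm ((1 / norm (y - x)) *\<^sub>R (f y - (f x + (y - x) \<bullet> D)))
        \<le> B * norm (y - x)"
      by (auto simp: eventually_at intro: exI[of _ 1])
  qed
qed

text \<open>
  The first order characterisation of strong convexity is the only form of convexity that occurs here,
  so it is taken as the definition.
\<close>

locale strongly_convex =
  fixes f :: "'a::euclidean_space \<Rightarrow> real" and g :: "'a \<Rightarrow> 'a" and c :: real
  assumes modulus_pos: "0 < c"
    and gradient: "GDERIV f a :> g a"
    and above_tangent: "c / 2 * (norm (b - a))\<^sup>2 \<le> f b - f a - g a \<bullet> (b - a)"
begin

lemma gradient_strongly_monotone: "c * (norm (b - a))\<^sup>2 \<le> (g b - g a) \<bullet> (b - a)"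
  using above_tangent[of b a] above_tangent[of a b]
  by (simp add: norm_minus_commute inner_diff_left inner_diff_right inner_commute)

text \<open>
  By Cauchy--Schwarz, strong monotonicity makes the inverse of the gradient Lipschitz. This is the
  estimate that turns perturbations of a gradient into perturbations of its zero.
\<close>

lemma gradient_expanding: "c * norm (b - a) \<le> norm (g b - g a)"
proof (cases "b = a")
  case False
  have "c * norm (b - a) * norm (b - a) \<le> norm (g b - g a) * norm (b - a)"
    using gradient_strongly_monotone[of b a] norm_cauchy_schwarz[of "g b - g a" "b - a"]
    by (simp add: power2_eq_square algebra_simps)
  then show ?thesis using False by simp
qed simp

text \<open>
  The tangent bound makes \<open>a \<mapsto> p \<bullet> a + f a\<close> coercive, so its minimum over a large ball is global, and
  the derivative vanishes there.
\<close>

lemma gradient_surj: "\<exists>a. g a = - p"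
proof -
  define h where "h a = p \<bullet> a + f a" for a
  have deriv: "(h has_derivative (\<lambda>v. v \<bullet> (p + g a))) (at a)" for a
  proof -
    have "((\<lambda>a. p \<bullet> a) has_derivative (\<lambda>v. p \<bullet> v)) (at a)"
      by (auto intro!: derivative_eq_intros)
    from has_derivative_add[OF this gradient[of a, unfolded gderiv_def]]
    show ?thesis by (simp add: h_def[abs_def] inner_add_right inner_commute)
  qed
  \<comment> \<open>Beyond this radius the quadratic term of the tangent bound dominates the linear one.\<close>
  define R where "R = 2 * norm (p + g 0) / c"
  have R: "0 \<le> R" using modulus_pos by (simp add: R_def)
  have coercive: "h 0 \<le> h b" if "R \<le> norm b" for b
  proof -
    have "norm (p + g 0) * norm b \<le> c / 2 * norm b * norm b"
      using that modulus_pos by (intro mult_right_mono) (auto simp: R_def field_simps)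
    moreover have "- (norm (p + g 0) * norm b) \<le> (p + g 0) \<bullet> b"
      using Cauchy_Schwarz_ineq2[of "p + g 0" b] by linarith
    ultimately show ?thesis
      using above_tangent[of b 0]
      by (simp add: h_def power2_eq_square algebra_simps)
  qed
  have "continuous_on (cball 0 R) h"
    by (intro continuous_at_imp_continuous_on ballI has_derivative_continuous[OF deriv])
  then obtain a where a: "\<And>b. norm b \<le> R \<Longrightarrow> h a \<le> h b"
    using continuous_attains_inf[of "cball 0 R" h] R by (force simp: mem_cball_0)
  have "h a \<le> h b" for b
    using a[of b] a[of 0] coercive[of b] R by fastforce
  then have "(\<lambda>v. v \<bullet> (p + g a)) = (\<lambda>v. 0)"
    by (intro differential_zero_maxmin[OF UNIV_I open_UNIV deriv]) auto
  then have "(p + g a) \<bullet> (p + g a) = 0" by metis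
  then show ?thesis by (metis add.commute add_eq_0_iff inner_eq_zero_iff)
qed

lemma critical_point_minimises:
  assumes "g a = - p"
  shows "p \<bullet> a + f a \<le> p \<bullet> b + f b"
proof -
  have "0 \<le> c / 2 * (norm (b - a))\<^sup>2" using modulus_pos by simp
  with above_tangent[of b a] assms show ?thesis by (simp add: inner_diff_right)
qed

lemma INF_eq_critical_value:
  assumes "g a = - p"
  shows "(INF b. p \<bullet> b + f b) = p \<bullet> a + f a"
proof (rule cInf_eq_minimum)
  show "p \<bullet> a + f a \<in> range (\<lambda>b. p \<bullet> b + f b)" by simp
qed (use critical_point_minimises[OF assms] in auto)

text \<open>
  An envelope theorem. Testing the infimum at \<open>q\<close> with the minimiser for \<open>p\<close>, and conversely, encloses
  the first order error between \<open>(q - p) \<bullet> (b - a)\<close> and \<open>0\<close>, where \<open>b\<close> is the minimiser for \<open>q\<close>. It is of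
  second order because minimisers depend Lipschitz continuously on the slope.
\<close>

lemma GDERIV_INF:
  assumes a: "g a = - p"
  shows "GDERIV (\<lambda>q. INF b. q \<bullet> b + f b) p :> a"
proof (rule GDERIV_quadratic_bound)
  fix q
  obtain b where b: "g b = - q" using gradient_surj by blast
  have "norm (b - a) \<le> norm (q - p) / c"
    using gradient_expanding[of b a] modulus_pos
    by (simp add: a b field_simps norm_minus_commute)
  then have "norm (q - p) * norm (b - a) \<le> norm (q - p) * (norm (q - p) / c)"
    by (intro mult_left_mono) auto
  moreover have "\<bar>(q - p) \<bullet> (b - a)\<bar> \<le> norm (q - p) * norm (b - a)"
    by (rule Cauchy_Schwarz_ineq2)
  ultimately have cs: "\<bar>(q - p) \<bullet> (b - a)\<bar> \<le> 1 / c * (norm (q - p))\<^sup>2"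
    by (simp add: power2_eq_square)
  show "\<bar>(INF b. q \<bullet> b + f b) - (INF b. p \<bullet> b + f b) - (q - p) \<bullet> a\<bar> \<le> 1 / c * (norm (q - p))\<^sup>2"
    using cs critical_point_minimises[OF a, of b] critical_point_minimises[OF b, of a]
    unfolding INF_eq_critical_value[OF a] INF_eq_critical_value[OF b]
    by (simp add: algebra_simps inner_diff_left inner_diff_right)
qed

end

section \<open>Laws and transport costs\<close>

lemma square_integrable_measurable: "square_integrable M X \<Longrightarrow> X \<in> borel_measurable M"
  by (simp add: square_integrable_def)

lemma (in prob_space) square_integrable_integrable:
  assumes "square_integrable M X"
  shows "integrable M (\<lambda>\<omega>. norm (X \<omega>))"
proof (rule Bochner_Integration.integrable_bound)
  show "integrable M (\<lambda>\<omega>. 1 + (norm (X \<omega>))\<^sup>2)"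
    using assms by (simp add: square_integrable_def)
  show "(\<lambda>\<omega>. norm (X \<omega>)) \<in> borel_measurable M"
    using assms by (auto simp: square_integrable_def)
  have "t \<le> 1 + t\<^sup>2" if "0 \<le> t" for t :: real
    using sum_squares_bound[of t 1] that by simp
  then show "AE \<omega> in M. norm (norm (X \<omega>)) \<le> norm (1 + (norm (X \<omega>))\<^sup>2)"
    by (intro AE_I2) auto
qed

lemma square_integrable_bound:
  assumes "square_integrable M X" "Y \<in> borel_measurable M"
    and "\<And>\<omega>. norm (Y \<omega>) \<le> norm (X \<omega>)"
  shows "square_integrable M Y"
  unfolding square_integrable_def
proof
  show "integrable M (\<lambda>\<omega>. (norm (Y \<omega>))\<^sup>2)"
    by (rule Bochner_Integration.integrable_bound[where f = "\<lambda>\<omega>. (norm (X \<omega>))\<^sup>2"])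
      (use assms in \<open>auto simp: square_integrable_def intro!: power_mono\<close>)
qed (fact assms(2))

lemma square_integrable_add:
  assumes "square_integrable M X" "square_integrable M Y"
  shows "square_integrable M (\<lambda>\<omega>. X \<omega> + Y \<omega>)"
  unfolding square_integrable_def
proof
  have m: "X \<in> borel_measurable M" "Y \<in> borel_measurable M"
    using assms by (auto simp: square_integrable_def)
  then show "(\<lambda>\<omega>. X \<omega> + Y \<omega>) \<in> borel_measurable M" by simp
  have "(norm (x + y))\<^sup>2 \<le> 2 * (norm x)\<^sup>2 + 2 * (norm y)\<^sup>2" for x y :: 'b
  proof -
    have "(norm (x + y))\<^sup>2 \<le> (norm x + norm y)\<^sup>2"
      by (intro power_mono norm_triangle_ineq) simp
    also have "\<dots> \<le> 2 * (norm x)\<^sup>2 + 2 * (norm y)\<^sup>2"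
      using sum_squares_bound[of "norm x" "norm y"] by (simp add: power2_sum)
    finally show ?thesis .
  qed
  then have bound: "AE \<omega> in M. norm ((norm (X \<omega> + Y \<omega>))\<^sup>2)
      \<le> norm (2 * (norm (X \<omega>))\<^sup>2 + 2 * (norm (Y \<omega>))\<^sup>2)"
    by simp
  show "integrable M (\<lambda>\<omega>. (norm (X \<omega> + Y \<omega>))\<^sup>2)"
    by (rule Bochner_Integration.integrable_bound[OF _ _ bound])
      (use assms m in \<open>auto simp: square_integrable_def\<close>)
qed

lemma (in prob_space) square_integrable_const: "square_integrable M (\<lambda>_. x)"
  by (simp add: square_integrable_def)

lemma (in prob_space) integrable_norm_diff:
  assumes "square_integrable M X" "square_integrable M Y"
  shows "integrable M (\<lambda>\<omega>. norm (X \<omega> - Y \<omega>))"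
proof -
  have "square_integrable M (\<lambda>\<omega>. X \<omega> + - Y \<omega>)"
    using assms(2) by (intro square_integrable_add assms(1)) (simp add: square_integrable_def)
  from square_integrable_integrable[OF this] show ?thesis by simp
qed

lemma P2_prob_space: "\<nu> \<in> P2 \<Longrightarrow> prob_space \<nu>"
  and P2_sets: "\<nu> \<in> P2 \<Longrightarrow> sets \<nu> = sets borel"
  by (auto simp: P2_def)

lemma P2_iff: "\<nu> \<in> P2 \<longleftrightarrow> prob_space \<nu> \<and> sets \<nu> = sets borel \<and> square_integrable \<nu> (\<lambda>z. z)"
proof -
  have "(\<lambda>z. z) \<in> borel_measurable \<nu>" if "sets \<nu> = sets borel"
    using measurable_ident_sets[OF that] by (simp add: id_def)
  then show ?thesis by (auto simp: P2_def square_integrable_def)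
qed

lemma P2_square_integrable_fst:
  fixes \<nu> :: "('a::euclidean_space \<times> 'a) measure"
  assumes "\<nu> \<in> P2"
  shows "square_integrable \<nu> fst"
proof (rule square_integrable_bound)
  show id: "square_integrable \<nu> (\<lambda>z. z)" using assms by (simp add: P2_iff)
  show "fst \<in> borel_measurable \<nu>"
    by (rule borel_measurable_continuous_on[OF _ square_integrable_measurable[OF id]])
      (intro continuous_intros)
  show "norm (fst z) \<le> norm z" for z :: "'a \<times> 'a"
    using norm_fst_le[of "fst z" "snd z"] by simp
qed

lemma law_in_P2:
  assumes "prob_space M" "square_integrable M X" "square_integrable M Y"
  shows "law M X Y \<in> P2"
proof -
  have m: "X \<in> borel_measurable M" "Y \<in> borel_measurable M"
    using assms by (auto simp: square_integrable_def)
  then have m2: "(\<lambda>\<omega>. (X \<omega>, Y \<omega>)) \<in> borel_measurable M" by (rule borel_measurable_Pair)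
  have "integrable M (\<lambda>\<omega>. (norm (X \<omega>, Y \<omega>))\<^sup>2)"
    using assms by (simp add: norm_Pair square_integrable_def)
  then show ?thesis
    using prob_space.prob_space_distr[OF assms(1) m2] m2
    by (simp add: P2_def law_def integrable_distr_eq)
qed

text \<open>Two random variables on one probability space couple their laws by their joint law.\<close>

lemma wasserstein_1_distr_le:
  fixes f g :: "'w \<Rightarrow> 'b::euclidean_space"
  assumes M: "prob_space M" and f: "f \<in> borel_measurable M" and g: "g \<in> borel_measurable M"
    and int: "integrable M (\<lambda>\<omega>. dist (f \<omega>) (g \<omega>))"
  shows "wasserstein 1 (distr M borel f) (distr M borel g) \<le> (\<integral>\<omega>. dist (f \<omega>) (g \<omega>) \<partial>M)"
proof -
  define \<pi> where "\<pi> = distr M borel (\<lambda>\<omega>. (f \<omega>, g \<omega>))"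
  have m: "(\<lambda>\<omega>. (f \<omega>, g \<omega>)) \<in> borel_measurable M" using f g by (rule borel_measurable_Pair)
  have proj: "fst \<in> borel_measurable borel" "snd \<in> borel_measurable borel"
    by (auto intro!: borel_measurable_continuous_onI continuous_intros)
  have dist_measurable: "(\<lambda>z :: 'b \<times> 'b. dist (fst z) (snd z)) \<in> borel_measurable borel"
    by (intro borel_measurable_continuous_onI continuous_intros)
  have "\<pi> \<in> couplings (distr M borel f) (distr M borel g)"
    using prob_space.prob_space_distr[OF M m]
    by (simp add: \<pi>_def couplings_def distr_distr[OF proj(1) m] distr_distr[OF proj(2) m] comp_def)
  then have "(INF \<pi>\<in>couplings (distr M borel f) (distr M borel g).
        \<integral>\<^sup>+ z. ennreal (dist (fst z) (snd z) powr 1) \<partial>\<pi>)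
      \<le> (\<integral>\<^sup>+ z. ennreal (dist (fst z) (snd z) powr 1) \<partial>\<pi>)"
    by (rule INF_lower)
  also have "\<dots> = (\<integral>\<^sup>+ \<omega>. ennreal (dist (f \<omega>) (g \<omega>)) \<partial>M)"
    unfolding \<pi>_def using dist_measurable by (subst nn_integral_distr[OF m]) simp_all
  also have "\<dots> = ennreal (\<integral>\<omega>. dist (f \<omega>) (g \<omega>) \<partial>M)"
    using int by (intro nn_integral_eq_integral) auto
  finally show ?thesis
    unfolding wasserstein_def by (simp add: enn2real_leI)
qed

section \<open>The fixed-point map of one Lagrangian\<close>

text \<open>
  What the fixed-point argument needs of a Lagrangian. The displacement condition is required only
  for laws that share the first component and the underlying probability space \<open>\<nu>\<close>; there its
  Lipschitz constant is written \<open>c * k\<close>, so that \<open>k\<close> becomes the contraction rate of \<open>dpH\<close>. The constant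
  \<open>K\<close> serves only to make \<open>dpH\<close> continuous in the position and of linear growth.
\<close>

locale contractive_lagrangian =
  fixes L :: "'a::euclidean_space lagrangian" and c k K :: real
  assumes modulus_pos: "0 < c" and rate_nonneg: "0 \<le> k" and rate_less_1: "k < 1"
    and GDERIV_da: "\<rho> \<in> P2 \<Longrightarrow> GDERIV (\<lambda>a'. L x a' \<rho>) a :> da L x a \<rho>"
    and above_tangent: "\<rho> \<in> P2 \<Longrightarrow>
      c / 2 * (norm (b - a))\<^sup>2 \<le> L x b \<rho> - L x a \<rho> - da L x a \<rho> \<bullet> (b - a)"
    and da_lipschitz: "\<rho> \<in> P2 \<Longrightarrow> norm (da L x a \<rho> - da L y a \<rho>) \<le> K * norm (x - y)"
    and da_law: "(\<nu> :: ('a \<times> 'a) measure) \<in> P2 \<Longrightarrow> square_integrable \<nu> \<alpha> \<Longrightarrow> square_integrable \<nu> \<beta> \<Longrightarrow>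
      norm (da L x a (law \<nu> fst \<alpha>) - da L x a (law \<nu> fst \<beta>))
        \<le> c * k * (\<integral>z. norm (\<alpha> z - \<beta> z) \<partial>\<nu>)"
begin

lemma strongly_convex_L:
  assumes "\<rho> \<in> P2"
  shows "strongly_convex (\<lambda>a. L x a \<rho>) (\<lambda>a. da L x a \<rho>) c"
  using modulus_pos GDERIV_da[OF assms] above_tangent[OF assms] by unfold_locales

lemma da_dpH:
  assumes "\<rho> \<in> P2"
  shows "da L x (dpH L x p \<rho>) \<rho> = - p"
proof -
  interpret strongly_convex "\<lambda>a. L x a \<rho>" "\<lambda>a. da L x a \<rho>" c
    by (rule strongly_convex_L[OF assms])
  obtain a where a: "da L x a \<rho> = - p" using gradient_surj by blast
  moreover have "dpH L x p \<rho> = a"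
    unfolding dpH_def hamiltonian_def by (intro grad_eqI GDERIV_INF a)
  ultimately show ?thesis by simp
qed

text \<open>
  The distance of any \<open>a\<close> from the minimiser is controlled by the defect of \<open>a\<close> in the first order
  condition. Both Lipschitz estimates below arise by inserting the minimiser for other data.
\<close>

lemma dpH_expanding:
  assumes "\<rho> \<in> P2"
  shows "c * norm (a - dpH L x p \<rho>) \<le> norm (da L x a \<rho> + p)"
  using strongly_convex.gradient_expanding[OF strongly_convex_L[OF assms], of a "dpH L x p \<rho>" x]
  by (simp add: da_dpH[OF assms])

lemma dpH_lipschitz:
  assumes "\<rho> \<in> P2"
  shows "c * norm (dpH L x p \<rho> - dpH L y q \<rho>) \<le> K * norm (x - y) + norm (p - q)"
proof -
  let ?a = "dpH L x p \<rho>"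
  have "c * norm (?a - dpH L y q \<rho>) \<le> norm (da L y ?a \<rho> + q)"
    by (rule dpH_expanding[OF assms])
  also have "da L y ?a \<rho> + q = (q - p) - (da L x ?a \<rho> - da L y ?a \<rho>)"
    by (simp add: da_dpH[OF assms])
  also have "norm \<dots> \<le> norm (q - p) + norm (da L x ?a \<rho> - da L y ?a \<rho>)"
    by (rule norm_triangle_ineq4)
  finally show ?thesis
    using da_lipschitz[OF assms, of x ?a y] by (simp add: norm_minus_commute)
qed

lemma K_nonneg: "0 \<le> K"
proof -
  obtain b :: 'a where b: "norm b = 1" using vector_choose_size[of 1] by auto
  have "return borel (0::'a \<times> 'a) \<in> P2"
    by (simp add: P2_iff prob_space_return square_integrable_def integrable_iff_bounded
        nn_integral_return)
  from order_trans[OF norm_ge_zero da_lipschitz[OF this, of b 0 0]] b show ?thesis by simp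
qed

lemma lipschitz_on_dpH:
  assumes "\<rho> \<in> P2"
  shows "((K + 1) / c)-lipschitz_on UNIV (\<lambda>z. dpH L (fst z) (snd z) \<rho>)"
proof (rule lipschitz_onI)
  fix z w :: "'a \<times> 'a"
  have "c * dist (dpH L (fst z) (snd z) \<rho>) (dpH L (fst w) (snd w) \<rho>)
      \<le> K * norm (fst z - fst w) + norm (snd z - snd w)"
    using dpH_lipschitz[OF assms] by (simp add: dist_norm)
  also have "\<dots> \<le> K * dist z w + dist z w"
    using K_nonneg dist_fst_le[of z w] dist_snd_le[of z w]
    by (intro add_mono mult_left_mono) (auto simp: dist_norm)
  finally show "dist (dpH L (fst z) (snd z) \<rho>) (dpH L (fst w) (snd w) \<rho>) \<le> (K + 1) / c * dist z w"
    using modulus_pos by (simp add: field_simps)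
qed (use K_nonneg modulus_pos in simp)

lemma continuous_on_dpH: "\<rho> \<in> P2 \<Longrightarrow> continuous_on UNIV (\<lambda>z. dpH L (fst z) (snd z) \<rho>)"
  by (rule lipschitz_on_continuous_on[OF lipschitz_on_dpH])

lemma measurable_dpH: "\<rho> \<in> P2 \<Longrightarrow> (\<lambda>z. dpH L (fst z) (snd z) \<rho>) \<in> borel_measurable borel"
  by (rule borel_measurable_continuous_onI[OF continuous_on_dpH])

lemma square_integrable_dpH:
  assumes \<nu>: "\<nu> \<in> P2" and \<rho>: "\<rho> \<in> P2"
  shows "square_integrable \<nu> (\<lambda>z. dpH L (fst z) (snd z) \<rho>)"
proof -
  interpret prob_space \<nu> by (rule P2_prob_space[OF \<nu>])
  let ?a = "\<lambda>z. dpH L (fst z) (snd z) \<rho>" and ?B = "(K + 1) / c"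
  have B: "0 \<le> ?B" using K_nonneg modulus_pos by simp
  have id: "square_integrable \<nu> (\<lambda>z. z)" using \<nu> by (simp add: P2_iff)
  have m: "?a \<in> borel_measurable \<nu>"
    using measurable_dpH[OF \<rho>] by (simp add: measurable_cong_sets[OF P2_sets[OF \<nu>] refl])
  have "square_integrable \<nu> (\<lambda>z. ?B *\<^sub>R z)"
    using id by (auto simp: square_integrable_def power_mult_distrib power_divide)
  then have "square_integrable \<nu> (\<lambda>z. ?a z - ?a 0)"
  proof (rule square_integrable_bound)
    show "(\<lambda>z. ?a z - ?a 0) \<in> borel_measurable \<nu>" using m by simp
    show "norm (?a z - ?a 0) \<le> norm (?B *\<^sub>R z)" for z
      using lipschitz_onD[OF lipschitz_on_dpH[OF \<rho>], of z 0] B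
      by (simp add: dist_norm abs_of_nonneg flip: abs_divide)
  qed
  from square_integrable_add[OF this square_integrable_const[of "?a 0"]]
  show ?thesis by simp
qed

text \<open>The contraction: uniform in \<open>x\<close> and \<open>p\<close>, with only an \<open>L\<^sup>1\<close> distance on the right.\<close>

lemma dpH_law:
  fixes \<nu> :: "('a \<times> 'a) measure"
  assumes \<nu>: "\<nu> \<in> P2" and "square_integrable \<nu> \<alpha>" "square_integrable \<nu> \<beta>"
  shows "norm (dpH L x p (law \<nu> fst \<alpha>) - dpH L x p (law \<nu> fst \<beta>))
    \<le> k * (\<integral>z. norm (\<alpha> z - \<beta> z) \<partial>\<nu>)"
proof -
  have P2: "law \<nu> fst \<alpha> \<in> P2" "law \<nu> fst \<beta> \<in> P2"
    by (rule law_in_P2[OF P2_prob_space[OF \<nu>] P2_square_integrable_fst[OF \<nu>]]; fact)+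
  let ?a = "dpH L x p (law \<nu> fst \<alpha>)"
  have "c * norm (?a - dpH L x p (law \<nu> fst \<beta>)) \<le> norm (da L x ?a (law \<nu> fst \<beta>) + p)"
    by (rule dpH_expanding[OF P2(2)])
  also have "\<dots> = norm (da L x ?a (law \<nu> fst \<alpha>) - da L x ?a (law \<nu> fst \<beta>))"
    by (simp add: da_dpH[OF P2(1)] norm_minus_commute[of "- p"])
  also have "\<dots> \<le> c * k * (\<integral>z. norm (\<alpha> z - \<beta> z) \<partial>\<nu>)"
    by (rule da_law[OF assms])
  finally show ?thesis using modulus_pos by (simp add: mult.assoc)
qed

text \<open>
  Writing \<open>\<rho> = law \<nu> fst \<alpha>\<close> turns the fixed-point equation for laws into one for feedbacks \<open>\<alpha>\<close>. Since
  the contraction bounds a supremum by an \<open>L\<^sup>1\<close> norm, any two values of the feedback operator differ by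
  a bounded continuous function. Hence the search is restricted to bounded continuous perturbations
  of one value \<open>\<alpha>0\<close>: they form a complete space under the supremum distance, which dominates the
  \<open>L\<^sup>1\<close> distance.
\<close>

lemma feedback_fixpoint_exists:
  assumes \<nu>: "\<nu> \<in> P2"
  obtains \<alpha> where "square_integrable \<nu> \<alpha>"
    and "\<And>z. \<alpha> z = dpH L (fst z) (snd z) (law \<nu> fst \<alpha>)"
proof -
  interpret prob_space \<nu> by (rule P2_prob_space[OF \<nu>])
  define T where "T \<alpha> = (\<lambda>z. dpH L (fst z) (snd z) (law \<nu> fst \<alpha>))" for \<alpha> :: "'a \<times> 'a \<Rightarrow> 'a"
  define \<alpha>0 where "\<alpha>0 = T (\<lambda>_. 0)"
  define perturb where "perturb \<beta> = (\<lambda>z. \<alpha>0 z + apply_bcontfun \<beta> z)" for \<beta> :: "('a \<times> 'a) \<Rightarrow>\<^sub>C 'a"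
  have law_P2: "law \<nu> fst \<alpha> \<in> P2" if "square_integrable \<nu> \<alpha>" for \<alpha>
    by (rule law_in_P2[OF P2_prob_space[OF \<nu>] P2_square_integrable_fst[OF \<nu>] that])
  have sq0: "square_integrable \<nu> (\<lambda>_. 0 :: 'a)" by (rule square_integrable_const)
  have sq_\<alpha>0: "square_integrable \<nu> \<alpha>0"
    unfolding \<alpha>0_def T_def by (rule square_integrable_dpH[OF \<nu> law_P2[OF sq0]])
  have sq: "square_integrable \<nu> (perturb \<beta>)" for \<beta>
  proof -
    have "apply_bcontfun \<beta> \<in> borel_measurable \<nu>"
      unfolding measurable_cong_sets[OF P2_sets[OF \<nu>] refl]
      by (intro borel_measurable_continuous_onI) simp
    then have "square_integrable \<nu> (apply_bcontfun \<beta>)"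
      by (rule square_integrable_bound[OF square_integrable_const[of "norm \<beta>"]])
        (simp add: norm_bounded)
    then show ?thesis
      unfolding perturb_def by (rule square_integrable_add[OF sq_\<alpha>0])
  qed
  define S where "S \<beta> = Bcontfun (\<lambda>z. T (perturb \<beta>) z - \<alpha>0 z)" for \<beta>
  have S: "apply_bcontfun (S \<beta>) z = T (perturb \<beta>) z - \<alpha>0 z" for \<beta> z
  proof -
    have "(\<lambda>z. T (perturb \<beta>) z - \<alpha>0 z) \<in> bcontfun"
    proof (rule bcontfun_normI)
      show "continuous_on UNIV (\<lambda>z. T (perturb \<beta>) z - \<alpha>0 z)"
        unfolding T_def \<alpha>0_def
        by (intro continuous_on_diff continuous_on_dpH law_P2 sq sq0)
      show "norm (T (perturb \<beta>) z - \<alpha>0 z) \<le> k * (\<integral>z. norm (perturb \<beta> z - 0) \<partial>\<nu>)" for z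
        unfolding T_def \<alpha>0_def by (rule dpH_law[OF \<nu> sq sq0])
    qed
    then show ?thesis unfolding S_def by (simp add: Bcontfun_inverse)
  qed
  have "dist (S \<beta>) (S \<gamma>) \<le> k * dist \<beta> \<gamma>" for \<beta> \<gamma>
  proof (rule dist_bound)
    fix z
    have "dist (S \<beta> z) (S \<gamma> z) = norm (T (perturb \<beta>) z - T (perturb \<gamma>) z)"
      by (simp add: S dist_norm)
    also have "\<dots> \<le> k * (\<integral>z. norm (perturb \<beta> z - perturb \<gamma> z) \<partial>\<nu>)"
      unfolding T_def by (rule dpH_law[OF \<nu> sq sq])
    also have "(\<integral>z. norm (perturb \<beta> z - perturb \<gamma> z) \<partial>\<nu>) \<le> dist \<beta> \<gamma>"
    proof (rule integral_le_const)
      show "integrable \<nu> (\<lambda>z. norm (perturb \<beta> z - perturb \<gamma> z))"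
        by (rule integrable_norm_diff[OF sq sq])
      show "AE z in \<nu>. norm (perturb \<beta> z - perturb \<gamma> z) \<le> dist \<beta> \<gamma>"
        using dist_bounded[of \<beta> _ \<gamma>] by (auto simp: perturb_def dist_norm)
    qed
    finally show "dist (S \<beta> z) (S \<gamma> z) \<le> k * dist \<beta> \<gamma>"
      using rate_nonneg by (simp add: mult_left_mono)
  qed
  then obtain \<beta> where "S \<beta> = \<beta>"
    using banach_fix_type[OF rate_nonneg rate_less_1, of S] by blast
  then have "perturb \<beta> z = T (perturb \<beta>) z" for z
    using S[of \<beta> z] by (simp add: perturb_def)
  then show ?thesis using that[OF sq[of \<beta>]] unfolding T_def by blast
qed

text \<open>
  Integrating the contraction for two fixed points gives \<open>I \<le> k * I\<close> for their \<open>L\<^sup>1\<close> distance \<open>I\<close>. So \<open>I\<close>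
  vanishes, and by the contraction again the feedbacks agree everywhere.
\<close>

lemma feedback_fixpoint_unique:
  assumes \<nu>: "\<nu> \<in> P2" and \<rho>: "\<rho> \<in> P2" and \<sigma>: "\<sigma> \<in> P2"
    and fix_\<rho>: "\<rho> = law \<nu> fst (\<lambda>z. dpH L (fst z) (snd z) \<rho>)"
    and fix_\<sigma>: "\<sigma> = law \<nu> fst (\<lambda>z. dpH L (fst z) (snd z) \<sigma>)"
  shows "\<rho> = \<sigma>"
proof -
  interpret prob_space \<nu> by (rule P2_prob_space[OF \<nu>])
  let ?a = "\<lambda>z. dpH L (fst z) (snd z) \<rho>" and ?b = "\<lambda>z. dpH L (fst z) (snd z) \<sigma>"
  let ?I = "\<integral>z. norm (?a z - ?b z) \<partial>\<nu>"
  note sq = square_integrable_dpH[OF \<nu> \<rho>] square_integrable_dpH[OF \<nu> \<sigma>]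
  have bound: "norm (?a z - ?b z) \<le> k * ?I" for z
    using dpH_law[OF \<nu> sq] fix_\<rho> fix_\<sigma> by simp
  have "?I \<le> k * ?I" using bound by (intro integral_le_const integrable_norm_diff sq) auto
  then have "(1 - k) * ?I \<le> 0" by (simp add: algebra_simps)
  then have "?I \<le> 0" using rate_less_1 by (simp add: mult_le_0_iff)
  then have "k * ?I \<le> 0" using rate_nonneg by (simp add: mult_nonneg_nonpos)
  then have "?a z = ?b z" for z using bound[of z] by (smt (verit) norm_le_zero_iff right_minus_eq)
  then have "?a = ?b" by blast
  then show ?thesis using fix_\<rho> fix_\<sigma> by metis
qed

lemma fixpoint_map:
  assumes \<nu>: "\<nu> \<in> P2"
  shows fixpoint_map_in_P2: "fixpoint_map L \<nu> \<in> P2"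
    and fixpoint_map_eq:
      "law \<nu> fst (\<lambda>z. dpH L (fst z) (snd z) (fixpoint_map L \<nu>)) = fixpoint_map L \<nu>"
proof -
  obtain \<alpha> where sq: "square_integrable \<nu> \<alpha>"
    and \<alpha>: "\<And>z. \<alpha> z = dpH L (fst z) (snd z) (law \<nu> fst \<alpha>)"
    by (rule feedback_fixpoint_exists[OF \<nu>]) blast
  have "\<exists>!\<rho>. \<rho> \<in> P2 \<and> \<rho> = law \<nu> fst (\<lambda>z. dpH L (fst z) (snd z) \<rho>)"
  proof (rule ex_ex1I)
    have "law \<nu> fst \<alpha> \<in> P2"
      by (rule law_in_P2[OF P2_prob_space[OF \<nu>] P2_square_integrable_fst[OF \<nu>] sq])
    moreover have "law \<nu> fst \<alpha> = law \<nu> fst (\<lambda>z. dpH L (fst z) (snd z) (law \<nu> fst \<alpha>))"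
      unfolding \<alpha>[symmetric] ..
    ultimately show "\<exists>\<rho>. \<rho> \<in> P2 \<and> \<rho> = law \<nu> fst (\<lambda>z. dpH L (fst z) (snd z) \<rho>)" by blast
  qed (use feedback_fixpoint_unique[OF \<nu>] in blast)
  from theI'[OF this] show "fixpoint_map L \<nu> \<in> P2"
    "law \<nu> fst (\<lambda>z. dpH L (fst z) (snd z) (fixpoint_map L \<nu>)) = fixpoint_map L \<nu>"
    unfolding fixpoint_map_def by simp_all
qed

end

text \<open>The rate is \<open>max 0 c1 / c0\<close> because \<open>c1\<close> may be negative.\<close>

lemma contractive_lagrangian_exists:
  fixes L :: "'a::euclidean_space lagrangian"
  assumes lip: "lipschitz_derivatives L" and conv: "convex_displacement L"
  obtains c k K where "contractive_lagrangian L c k K"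
proof -
  obtain c where c: "0 < c"
    and convex: "\<forall>x a1 a2. \<forall>\<rho>\<in>P2.
      L x a2 \<rho> - L x a1 \<rho> - da L x a1 \<rho> \<bullet> (a2 - a1) \<ge> c / 2 * (norm (a2 - a1))\<^sup>2"
    and displacement: "\<exists>c1<c. \<exists>C>0.
      \<forall>x a. \<forall>(M :: (('a \<times> 'a) \<times> ('a \<times> 'a)) measure) X1 X2 \<alpha>1 \<alpha>2.
        prob_space M \<longrightarrow>
        square_integrable M X1 \<longrightarrow> square_integrable M X2 \<longrightarrow>
        square_integrable M \<alpha>1 \<longrightarrow> square_integrable M \<alpha>2 \<longrightarrow>
        norm (da L x a (law M X1 \<alpha>1) - da L x a (law M X2 \<alpha>2))
          \<le> C * (\<integral>\<omega>. norm (X1 \<omega> - X2 \<omega>) \<partial>M) + c1 * (\<integral>\<omega>. norm (\<alpha>1 \<omega> - \<alpha>2 \<omega>) \<partial>M)"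
    using conv unfolding convex_displacement_def by blast
  from displacement obtain c1 C where c1: "c1 < c"
    and coupling: "\<And>x a (M :: (('a \<times> 'a) \<times> ('a \<times> 'a)) measure) X1 X2 \<alpha>1 \<alpha>2.
      prob_space M \<Longrightarrow> square_integrable M X1 \<Longrightarrow> square_integrable M X2 \<Longrightarrow>
      square_integrable M \<alpha>1 \<Longrightarrow> square_integrable M \<alpha>2 \<Longrightarrow>
      norm (da L x a (law M X1 \<alpha>1) - da L x a (law M X2 \<alpha>2))
        \<le> C * (\<integral>\<omega>. norm (X1 \<omega> - X2 \<omega>) \<partial>M) + c1 * (\<integral>\<omega>. norm (\<alpha>1 \<omega> - \<alpha>2 \<omega>) \<partial>M)"
  proof (elim exE conjE)
    fix c1 C assume "c1 < c"
      and "\<forall>x a. \<forall>(M :: (('a \<times> 'a) \<times> ('a \<times> 'a)) measure) X1 X2 \<alpha>1 \<alpha>2.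
        prob_space M \<longrightarrow>
        square_integrable M X1 \<longrightarrow> square_integrable M X2 \<longrightarrow>
        square_integrable M \<alpha>1 \<longrightarrow> square_integrable M \<alpha>2 \<longrightarrow>
        norm (da L x a (law M X1 \<alpha>1) - da L x a (law M X2 \<alpha>2))
          \<le> C * (\<integral>\<omega>. norm (X1 \<omega> - X2 \<omega>) \<partial>M) + c1 * (\<integral>\<omega>. norm (\<alpha>1 \<omega> - \<alpha>2 \<omega>) \<partial>M)"
    then show thesis by (intro that[of c1 C]) blast+
  qed
  from lip obtain K where K: "\<forall>x1 x2 a1 a2. \<forall>\<rho>1\<in>P2. \<forall>\<rho>2\<in>P2.
      norm (dx L x1 a1 \<rho>1 - dx L x2 a2 \<rho>2)
        \<le> K * (norm (x1 - x2) + norm (a1 - a2) + wasserstein 1 \<rho>1 \<rho>2) \<and>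
      norm (da L x1 a1 \<rho>1 - da L x2 a2 \<rho>2)
        \<le> K * (norm (x1 - x2) + norm (a1 - a2) + wasserstein 1 \<rho>1 \<rho>2)"
    unfolding lipschitz_derivatives_def by (elim conjE exE) (rule that)
  have "contractive_lagrangian L c (max 0 c1 / c) K"
  proof
    show "0 < c" by (fact c)
    show "0 \<le> max 0 c1 / c" "max 0 c1 / c < 1" using c c1 by auto
    show "c / 2 * (norm (b - a))\<^sup>2 \<le> L x b \<rho> - L x a \<rho> - da L x a \<rho> \<bullet> (b - a)"
      if "\<rho> \<in> P2" for \<rho> x a b using convex that by blast
    show "GDERIV (\<lambda>a'. L x a' \<rho>) a :> da L x a \<rho>" if \<rho>: "\<rho> \<in> P2" for \<rho> x a
    proof -
      obtain D where D: "GDERIV (\<lambda>a'. L x a' \<rho>) a :> D"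
        using lip \<rho> unfolding lipschitz_derivatives_def by blast
      then show ?thesis using grad_eqI[OF D] by (simp add: da_def)
    qed
    show "norm (da L x a \<rho> - da L y a \<rho>) \<le> K * norm (x - y)" if \<rho>: "\<rho> \<in> P2" for \<rho> x y a
    proof -
      have id: "(\<lambda>z. z) \<in> borel_measurable \<rho>"
        using \<rho> unfolding P2_iff square_integrable_def by simp
      have "wasserstein 1 (distr \<rho> borel (\<lambda>z. z)) (distr \<rho> borel (\<lambda>z. z)) \<le> 0"
        using wasserstein_1_distr_le[OF P2_prob_space[OF \<rho>] id id] by simp
      moreover have "distr \<rho> borel (\<lambda>z. z) = \<rho>" by (rule distr_id2) (simp add: P2_sets[OF \<rho>])
      moreover have "0 \<le> wasserstein 1 \<rho> \<rho>" by (simp add: wasserstein_def)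
      ultimately have "wasserstein 1 \<rho> \<rho> = 0" by simp
      then show ?thesis
        using K[rule_format, OF \<rho> \<rho>, of x a y a] by simp
    qed
    show "norm (da L x a (law \<nu> fst \<alpha>) - da L x a (law \<nu> fst \<beta>))
        \<le> c * (max 0 c1 / c) * (\<integral>z. norm (\<alpha> z - \<beta> z) \<partial>\<nu>)"
      if \<nu>: "\<nu> \<in> P2" and sq: "square_integrable \<nu> \<alpha>" "square_integrable \<nu> \<beta>"
      for \<nu> :: "('a \<times> 'a) measure" and \<alpha> \<beta> x a
    proof -
      \<comment> \<open>The displacement condition speaks of probability measures on a product of two copies of the
        carrier of \<open>\<nu>\<close>. The image of \<open>\<nu>\<close> on the diagonal is such a measure, and functions of the first
        copy have the same laws and integrals there as under \<open>\<nu>\<close>. Both laws then have the same first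
        component, so the term with \<open>C\<close> vanishes.\<close>
      define M where "M = distr \<nu> (borel \<Otimes>\<^sub>M borel) (\<lambda>z. (z, z))"
      have id: "(\<lambda>z. z) \<in> borel_measurable \<nu>"
        using \<nu> unfolding P2_iff square_integrable_def by simp
      have diag: "(\<lambda>z. (z, z)) \<in> \<nu> \<rightarrow>\<^sub>M borel \<Otimes>\<^sub>M borel"
        using id by simp
      have M: "prob_space M"
        unfolding M_def by (rule prob_space.prob_space_distr[OF P2_prob_space[OF \<nu>] diag])
      have meas: "(\<lambda>\<omega>. f (fst \<omega>)) \<in> borel \<Otimes>\<^sub>M borel \<rightarrow>\<^sub>M borel"
        if "square_integrable \<nu> f" for f :: "'a \<times> 'a \<Rightarrow> 'a"
      proof -
        have [measurable]: "f \<in> borel_measurable borel"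
          using that by (simp add: square_integrable_def measurable_cong_sets[OF P2_sets[OF \<nu>] refl])
        show ?thesis by measurable
      qed
      have lift: "square_integrable M (\<lambda>\<omega>. f (fst \<omega>))"
        if "square_integrable \<nu> f" for f :: "'a \<times> 'a \<Rightarrow> 'a"
      proof -
        note [measurable] = meas[OF that]
        have "(\<lambda>\<omega>. (norm (f (fst \<omega>)))\<^sup>2) \<in> borel_measurable (borel \<Otimes>\<^sub>M borel)"
          by measurable
        from integrable_distr_eq[OF diag this] show ?thesis
          using that meas[OF that] by (simp add: square_integrable_def M_def)
      qed
      have law: "law M (\<lambda>\<omega>. fst (fst \<omega>)) (\<lambda>\<omega>. f (fst \<omega>)) = law \<nu> fst f"
        if "square_integrable \<nu> f" for f :: "'a \<times> 'a \<Rightarrow> 'a"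
        unfolding law_def M_def
          distr_distr[OF borel_measurable_Pair[OF meas[OF P2_square_integrable_fst[OF \<nu>]]
              meas[OF that]] diag]
        by (simp add: comp_def)
      have cost: "(\<integral>\<omega>. norm (\<alpha> (fst \<omega>) - \<beta> (fst \<omega>)) \<partial>M) = (\<integral>z. norm (\<alpha> z - \<beta> z) \<partial>\<nu>)"
        unfolding M_def
        by (subst integral_distr[OF diag measurable_compose[OF
              borel_measurable_diff[OF meas[OF sq(1)] meas[OF sq(2)]] borel_measurable_norm]]) simp
      have "norm (da L x a (law \<nu> fst \<alpha>) - da L x a (law \<nu> fst \<beta>))
          \<le> c1 * (\<integral>z. norm (\<alpha> z - \<beta> z) \<partial>\<nu>)"
        using coupling[OF M lift lift lift lift, OF P2_square_integrable_fst[OF \<nu>]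
            P2_square_integrable_fst[OF \<nu>] sq, of x a]
        by (simp add: law sq cost)
      also have "\<dots> \<le> max 0 c1 * (\<integral>z. norm (\<alpha> z - \<beta> z) \<partial>\<nu>)"
        by (intro mult_right_mono) auto
      finally show ?thesis using c by simp
    qed
  qed
  then show ?thesis by (rule that)
qed

section \<open>Comparison of two fixed-point maps\<close>

text \<open>
  Replacing \<open>\<sigma>\<close> by \<open>\<rho>\<close> inside \<open>dpH L1\<close> costs at most \<open>k1\<close> times the \<open>L\<^sup>1\<close> distance of the two feedbacks,
  which is absorbed on the left. What remains compares the two Hamiltonians at the same law \<open>\<rho>\<close>.
\<close>

lemma fixpoint_map_comparison:
  fixes L1 L2 :: "'a::euclidean_space lagrangian"
  assumes "contractive_lagrangian L1 c1 k1 K1" and "contractive_lagrangian L2 c2 k2 K2"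
    and \<nu>: "\<nu> \<in> P2"
  defines "\<rho> \<equiv> fixpoint_map L2 \<nu>"
  shows "wasserstein 1 (fixpoint_map L1 \<nu>) \<rho>
    \<le> 1 / (1 - k1) * (\<integral>z. norm (dpH L1 (fst z) (snd z) \<rho> - dpH L2 (fst z) (snd z) \<rho>) \<partial>\<nu>)"
proof -
  interpret L1: contractive_lagrangian L1 c1 k1 K1 by fact
  interpret L2: contractive_lagrangian L2 c2 k2 K2 by fact
  interpret prob_space \<nu> by (rule P2_prob_space[OF \<nu>])
  define \<sigma> where "\<sigma> = fixpoint_map L1 \<nu>"
  have P2: "\<sigma> \<in> P2" "\<rho> \<in> P2"
    unfolding \<sigma>_def \<rho>_def using L1.fixpoint_map_in_P2 L2.fixpoint_map_in_P2 \<nu> by auto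
  define \<alpha> where "\<alpha> = (\<lambda>z. dpH L1 (fst z) (snd z) \<sigma>)"
  define \<beta> where "\<beta> = (\<lambda>z. dpH L2 (fst z) (snd z) \<rho>)"
  define \<gamma> where "\<gamma> = (\<lambda>z. dpH L1 (fst z) (snd z) \<rho>)"
  have sq: "square_integrable \<nu> \<alpha>" "square_integrable \<nu> \<beta>" "square_integrable \<nu> \<gamma>"
    unfolding \<alpha>_def \<beta>_def \<gamma>_def
    by (intro L1.square_integrable_dpH L2.square_integrable_dpH \<nu> P2)+
  have law: "law \<nu> fst \<alpha> = \<sigma>" "law \<nu> fst \<beta> = \<rho>"
    unfolding \<alpha>_def \<beta>_def \<sigma>_def \<rho>_def
    by (rule L1.fixpoint_map_eq[OF \<nu>] L2.fixpoint_map_eq[OF \<nu>])+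
  let ?I = "\<integral>z. norm (\<alpha> z - \<beta> z) \<partial>\<nu>"
  have "norm (\<alpha> z - \<beta> z) \<le> k1 * ?I + norm (\<gamma> z - \<beta> z)" for z
  proof -
    have "norm (\<alpha> z - \<gamma> z) \<le> k1 * ?I"
      using L1.dpH_law[OF \<nu> sq(1,2)] unfolding law by (simp add: \<alpha>_def \<gamma>_def)
    then show ?thesis using norm_triangle_ineq[of "\<alpha> z - \<gamma> z" "\<gamma> z - \<beta> z"] by simp
  qed
  then have "?I \<le> (\<integral>z. k1 * ?I + norm (\<gamma> z - \<beta> z) \<partial>\<nu>)"
    by (intro integral_mono Bochner_Integration.integrable_add integrable_norm_diff sq) auto
  also have "\<dots> = k1 * ?I + (\<integral>z. norm (\<gamma> z - \<beta> z) \<partial>\<nu>)"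
    using integrable_norm_diff[OF sq(3,2)] by (simp add: prob_space)
  finally have "(1 - k1) * ?I \<le> (\<integral>z. norm (\<gamma> z - \<beta> z) \<partial>\<nu>)" by (simp add: algebra_simps)
  then have I: "?I \<le> 1 / (1 - k1) * (\<integral>z. norm (\<gamma> z - \<beta> z) \<partial>\<nu>)"
    using L1.rate_less_1 by (simp add: field_simps)
  have dist: "dist (fst z, \<alpha> z) (fst z, \<beta> z) = norm (\<alpha> z - \<beta> z)" for z
    by (simp add: dist_Pair_Pair dist_norm)
  have "wasserstein 1 (law \<nu> fst \<alpha>) (law \<nu> fst \<beta>) \<le> ?I"
    using wasserstein_1_distr_le[of \<nu> "\<lambda>z. (fst z, \<alpha> z)" "\<lambda>z. (fst z, \<beta> z)"]
      prob_space_axioms sq[THEN square_integrable_measurable]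
      P2_square_integrable_fst[OF \<nu>, THEN square_integrable_measurable] integrable_norm_diff[OF sq(1,2)]
    by (simp add: law_def dist)
  then show ?thesis using I unfolding law by (simp add: \<sigma>_def \<beta>_def \<gamma>_def)
qed

theorem proposition2p14:
  fixes L1 L2 :: "(real ^ 'd) lagrangian"
  assumes "lipschitz_derivatives L1" and "lipschitz_derivatives L2"
    and "convex_displacement L1" and "convex_displacement L2"
    and "quadratic_growth L1" and "quadratic_growth L2"
  shows "\<exists>C. \<forall>\<nu>\<in>P2. \<forall>(M :: 'w measure) X Y.
      prob_space M \<longrightarrow> square_integrable M X \<longrightarrow> square_integrable M Y \<longrightarrow> law M X Y = \<nu> \<longrightarrow>
      wasserstein 1 (fixpoint_map L1 \<nu>) (fixpoint_map L2 \<nu>)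
        \<le> C * (\<integral>\<omega>. norm (dpH L1 (X \<omega>) (Y \<omega>) (fixpoint_map L2 \<nu>)
                        - dpH L2 (X \<omega>) (Y \<omega>) (fixpoint_map L2 \<nu>)) \<partial>M)"
proof -
  obtain c1 k1 K1 where L1: "contractive_lagrangian L1 c1 k1 K1"
    by (rule contractive_lagrangian_exists[OF assms(1,3)])
  obtain c2 k2 K2 where L2: "contractive_lagrangian L2 c2 k2 K2"
    by (rule contractive_lagrangian_exists[OF assms(2,4)])
  show ?thesis
  \<comment> \<open>The comparison holds on \<open>\<nu>\<close> with its coordinate maps; a change of variables carries the
    right-hand side over to any \<open>(X, Y)\<close> with law \<open>\<nu>\<close>.\<close>
  proof (intro exI[of _ "1 / (1 - k1)"] ballI allI impI)
    fix \<nu> :: "((real ^ 'd) \<times> (real ^ 'd)) measure" and M :: "'w measure" and X Y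
    assume \<nu>: "\<nu> \<in> P2" and "square_integrable M X" "square_integrable M Y" and law: "law M X Y = \<nu>"
    then have XY: "(\<lambda>\<omega>. (X \<omega>, Y \<omega>)) \<in> borel_measurable M"
      by (simp add: square_integrable_def borel_measurable_Pair)
    let ?\<rho> = "fixpoint_map L2 \<nu>"
    let ?h = "\<lambda>z. norm (dpH L1 (fst z) (snd z) ?\<rho> - dpH L2 (fst z) (snd z) ?\<rho>)"
    have \<rho>: "?\<rho> \<in> P2" by (rule contractive_lagrangian.fixpoint_map_in_P2[OF L2 \<nu>])
    have h: "?h \<in> borel_measurable borel"
      using contractive_lagrangian.measurable_dpH[OF L1 \<rho>]
        contractive_lagrangian.measurable_dpH[OF L2 \<rho>] by simp
    have "(\<integral>z. ?h z \<partial>\<nu>) = (\<integral>\<omega>. ?h (X \<omega>, Y \<omega>) \<partial>M)"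
      unfolding law[symmetric] law_def by (rule integral_distr[OF XY h[unfolded law[symmetric] law_def]])
    with fixpoint_map_comparison[OF L1 L2 \<nu>]
    show "wasserstein 1 (fixpoint_map L1 \<nu>) ?\<rho>
        \<le> 1 / (1 - k1) * (\<integral>\<omega>. norm (dpH L1 (X \<omega>) (Y \<omega>) ?\<rho> - dpH L2 (X \<omega>) (Y \<omega>) ?\<rho>) \<partial>M)"
      by simp
  qed
qed

end
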